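(* Let $G$ be a highly regular graph on $n$ vertices. Then $$\frac12\mathcal{E}(G)\ge n-\vartheta^-(G).$$
   Context: Graphs are finite, simple, undirected, with adjacency matrix $A$; $I$ is the identity and $J$ the all-ones $n\times n$ matrix; $\circ$ is the entrywise (Schur) product and $\langle X,Y\rangle=\mathrm{tr}(X^TY)$. $\mathcal{E}(G)$ is the energy of $G$: the sum of the absolute values of the adjacency eigenvalues. The Schrijver theta number is $\vartheta^-(G)=\max\{\langle J,X\rangle : X\succcurlyeq 0,\ X\ge 0 \text{ entrywise},\ \langle I,X\rangle=1,\ X\circ A=0\}$. $G$ is highly regular if there is a matrix algebra $\mathcal{A}$ of real $n\times n$ matrices (a linear subspace closed under matrix multiplication) such that: (1) $A,I,J\in\mathcal{A}$; (2) every element of $\mathcal{A}$ has constant diagonal; (3) $\mathcal{A}$ has a basis $\{B_1,\dots,B_k\}$ of $0/1$-matrices which is closed under transposition and splits $A$, i.e. there is an index set $I_0$ with $A=\sum_{i\in I_0}B_i$ and $A\circ B_j=0$ for all $j\notin I_0$. *)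

theory Defs
  imports "HOL-Analysis.Analysis" "HOL-Computational_Algebra.Polynomial"
begin

text \<open>
  A finite simple graph is a symmetric irreflexive relation on a finite vertex type;
  \<open>n\<close> is \<open>CARD('n)\<close>. Matrices are \<open>real ^ 'n ^ 'n\<close>, with \<open>**\<close> the matrix product and
  \<open>mat 1\<close> the identity.
\<close>

definition simple_graph :: "('n::finite \<Rightarrow> 'n \<Rightarrow> bool) \<Rightarrow> bool" where
  "simple_graph E \<longleftrightarrow> symp E \<and> irreflp E"

definition adj_matrix :: "('n::finite \<Rightarrow> 'n \<Rightarrow> bool) \<Rightarrow> real ^ 'n ^ 'n" where
  "adj_matrix E = (\<chi> i j. if E i j then 1 else 0)"

definition all_ones :: "real ^ 'n ^ 'n::finite" where
  "all_ones = (\<chi> i j. 1)"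

definition schur_prod :: "real ^ 'n ^ 'n \<Rightarrow> real ^ 'n ^ 'n \<Rightarrow> real ^ 'n ^ 'n::finite" where
  "schur_prod X Y = (\<chi> i j. X $ i $ j * Y $ i $ j)"

definition mat_inner :: "real ^ 'n ^ 'n \<Rightarrow> real ^ 'n ^ 'n::finite \<Rightarrow> real" where
  "mat_inner X Y = trace (transpose X ** Y)"

definition psd :: "real ^ 'n ^ 'n::finite \<Rightarrow> bool" where
  "psd X \<longleftrightarrow> transpose X = X \<and> (\<forall>v. v \<bullet> (X *v v) \<ge> 0)"

definition charpoly :: "real ^ 'n ^ 'n::finite \<Rightarrow> real poly" where
  "charpoly M = det (\<chi> i j. (if i = j then [:0, 1:] else 0) - [:M $ i $ j:])"

text \<open>
  \<open>proots\<close> is the multiset of roots, so eigenvalues are counted with multiplicity. Only real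
  roots are collected; since the adjacency matrix is symmetric, these are all the eigenvalues.
\<close>

definition energy :: "('n::finite \<Rightarrow> 'n \<Rightarrow> bool) \<Rightarrow> real" where
  "energy E = (\<Sum>x\<in>#proots (charpoly (adj_matrix E)). \<bar>x\<bar>)"

definition theta_minus_feasible :: "('n::finite \<Rightarrow> 'n \<Rightarrow> bool) \<Rightarrow> (real ^ 'n ^ 'n) set" where
  "theta_minus_feasible E =
     {X. psd X \<and> (\<forall>i j. X $ i $ j \<ge> 0) \<and> mat_inner (mat 1) X = 1 \<and>
         schur_prod X (adj_matrix E) = 0}"

text \<open>The supremum is a maximum; see \<open>theta_minus_is_max\<close> below.\<close>

definition theta_minus :: "('n::finite \<Rightarrow> 'n \<Rightarrow> bool) \<Rightarrow> real" where
  "theta_minus E = (SUP X\<in>theta_minus_feasible E. mat_inner all_ones X)"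

definition matrix_algebra :: "(real ^ 'n ^ 'n::finite) set \<Rightarrow> bool" where
  "matrix_algebra \<A> \<longleftrightarrow> subspace \<A> \<and> (\<forall>X\<in>\<A>. \<forall>Y\<in>\<A>. X ** Y \<in> \<A>)"

definition highly_regular :: "('n::finite \<Rightarrow> 'n \<Rightarrow> bool) \<Rightarrow> bool" where
  "highly_regular E \<longleftrightarrow> (\<exists>\<A>. matrix_algebra \<A> \<and>
     adj_matrix E \<in> \<A> \<and> mat 1 \<in> \<A> \<and> all_ones \<in> \<A> \<and>
     (\<forall>X\<in>\<A>. \<exists>c. \<forall>i. X $ i $ i = c) \<and>
     (\<exists>\<B>. independent \<B> \<and> span \<B> = \<A> \<and>
        (\<forall>B\<in>\<B>. \<forall>i j. B $ i $ j \<in> {0, 1}) \<and>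
        (\<forall>B\<in>\<B>. transpose B \<in> \<B>) \<and>
        (\<exists>S\<subseteq>\<B>. adj_matrix E = \<Sum>S \<and> (\<forall>B\<in>\<B> - S. schur_prod (adj_matrix E) B = 0))))"

lemma mat_inner_eq_inner: "mat_inner X Y = X \<bullet> Y"
  unfolding mat_inner_def trace_def matrix_matrix_mult_def transpose_def inner_vec_def
  by (simp, rule sum.swap)

lemma compact_theta_minus_feasible:
  fixes E :: "'n::finite \<Rightarrow> 'n \<Rightarrow> bool"
  shows "compact (theta_minus_feasible E)"
proof -
  have eq: "theta_minus_feasible E =
      {X. transpose X = X} \<inter> (\<Inter>v. {X. 0 \<le> v \<bullet> (X *v v)}) \<inter>
      (\<Inter>i. \<Inter>j. {X. 0 \<le> X $ i $ j}) \<inter> {X. mat 1 \<bullet> X = 1} \<inter>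
      (\<Inter>i. \<Inter>j. {X. X $ i $ j * adj_matrix E $ i $ j = 0})"
    unfolding theta_minus_feasible_def psd_def schur_prod_def mat_inner_eq_inner
    by (auto simp: vec_eq_iff)
  have "closed (theta_minus_feasible E)"
    unfolding eq transpose_def matrix_vector_mult_def inner_vec_def
    by (intro closed_Int closed_INT ballI closed_Collect_le closed_Collect_eq continuous_intros)
  moreover have "norm X \<le> (\<Sum>i\<in>(UNIV::'n set). \<Sum>j\<in>(UNIV::'n set). 1)"
    if X: "X \<in> theta_minus_feasible E" for X
  proof -
    have sym: "X $ i $ j = X $ j $ i" and nn: "0 \<le> X $ i $ j" for i j
      using X by (auto simp: theta_minus_feasible_def psd_def transpose_def vec_eq_iff)
    have tr: "(\<Sum>i\<in>UNIV. X $ i $ i) = 1"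
    proof -
      have "mat 1 \<bullet> X = (\<Sum>i\<in>UNIV. X $ i $ i)"
        by (simp add: inner_vec_def mat_def if_distrib[of "\<lambda>x. x * _"] cong: if_cong)
      then show ?thesis
        using X by (simp add: theta_minus_feasible_def mat_inner_eq_inner)
    qed
    have diag: "X $ i $ i \<le> 1" for i
      unfolding tr[symmetric] by (rule member_le_sum) (auto simp: nn)
    have entry: "X $ i $ j \<le> 1" for i j
    proof (cases "i = j")
      case False
      have "0 \<le> (axis i 1 - axis j 1) \<bullet> (X *v (axis i 1 - axis j 1))"
        using X by (simp add: theta_minus_feasible_def psd_def)
      also have "\<dots> = X $ i $ i + X $ j $ j - 2 * X $ i $ j"
        using sym[of i j]
        by (simp add: matrix_vector_mult_diff_distrib inner_diff_left
            inner_axis' matrix_vector_mult_basis column_def)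
      finally show ?thesis
        using diag[of i] diag[of j] by linarith
    qed (use diag in auto)
    have "norm X \<le> (\<Sum>i\<in>UNIV. norm (X $ i))"
      by (simp add: norm_vec_def L2_set_le_sum)
    also have "\<dots> \<le> (\<Sum>i\<in>(UNIV::'n set). \<Sum>j\<in>(UNIV::'n set). 1)"
    proof (rule sum_mono)
      fix i
      have "norm (X $ i) \<le> (\<Sum>j\<in>UNIV. \<bar>X $ i $ j\<bar>)"
        by (rule norm_le_l1_cart)
      also have "\<dots> \<le> (\<Sum>j\<in>(UNIV::'n set). 1)"
        by (rule sum_mono) (use entry nn in \<open>simp add: abs_of_nonneg\<close>)
      finally show "norm (X $ i) \<le> (\<Sum>j\<in>(UNIV::'n set). 1)" .
    qed
    finally show ?thesis .
  qed
  ultimately show ?thesis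
    by (auto simp: compact_eq_bounded_closed bounded_iff)
qed

lemma theta_minus_feasible_nonempty:
  fixes E :: "'n::finite \<Rightarrow> 'n \<Rightarrow> bool"
  assumes "simple_graph E"
  shows "theta_minus_feasible E \<noteq> {}"
proof -
  define X :: "real ^ 'n ^ 'n" where "X = mat (1 / CARD('n))"
  have 1: "X *v v = (1 / CARD('n)) *\<^sub>R v" for v
    by (simp add: X_def vec_eq_iff matrix_vector_mult_def mat_def if_distrib[of "\<lambda>x. x * _"]
        cong: if_cong)
  have "psd X"
    unfolding psd_def by (auto simp: 1) (simp add: X_def)
  moreover have "mat_inner (mat 1) X = 1"
    unfolding mat_inner_def X_def
    by (simp add: trace_def) (simp add: mat_def)
  moreover have "schur_prod X (adj_matrix E) = 0"
    using assms by (auto simp: simple_graph_def schur_prod_def X_def adj_matrix_def mat_def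
        vec_eq_iff irreflp_def)
  ultimately have "X \<in> theta_minus_feasible E"
    by (auto simp: theta_minus_feasible_def X_def mat_def)
  then show ?thesis by blast
qed

lemma theta_minus_is_max:
  assumes "simple_graph E"
  obtains X where "X \<in> theta_minus_feasible E" "mat_inner all_ones X = theta_minus E"
    "\<And>Y. Y \<in> theta_minus_feasible E \<Longrightarrow> mat_inner all_ones Y \<le> theta_minus E"
proof -
  have "continuous_on (theta_minus_feasible E) (mat_inner all_ones)"
    unfolding mat_inner_eq_inner by (intro continuous_intros)
  from continuous_attains_sup[OF compact_theta_minus_feasible
      theta_minus_feasible_nonempty[OF assms] this]
  obtain X where X: "X \<in> theta_minus_feasible E"
    and max: "\<And>Y. Y \<in> theta_minus_feasible E \<Longrightarrow> mat_inner all_ones Y \<le> mat_inner all_ones X"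
    by blast
  have "theta_minus E = mat_inner all_ones X"
    unfolding theta_minus_def by (rule cSup_eq_maximum) (use X max in auto)
  with X max show ?thesis by (intro that) auto
qed

end

theory Submission
  imports Defs
begin

text \<open>
  Let \<open>t\<close> be the optimum of \<open>\<langle>J, Y\<rangle>\<close> over positive semidefinite \<open>Y\<close> of trace one that are nonpositive on
  the non-edges, which is \<open>\<vartheta>\<^sup>+\<close> of the complement. By conic duality \<open>\<vartheta>\<^sup>- \<ge> n / t\<close>. For an optimal \<open>Y\<close>
  and a unit vector \<open>v\<close>, the matrix \<open>Y \<circ> (J + v v\<^sup>T)\<close> is feasible up to scaling, because \<open>J + v v\<^sup>T\<close> is
  both positive semidefinite and entrywise nonnegative; comparing its value with the optimum gives
  \<open>v\<^sup>T Y v \<le> t v\<^sup>T D v\<close>, where \<open>D\<close> is the diagonal part of \<open>Y\<close>. Now let \<open>A\<^sub>+\<close> be the positive part of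
  \<open>A\<close>. It is a polynomial in \<open>A\<close>, so it lies in the algebra and its diagonal is constant, equal to
  \<open>e / n\<close> for \<open>e = \<E>(G) / 2\<close>. Hence
  \<open>t - 1 = \<langle>J - I, Y\<rangle> \<le> \<langle>A, Y\<rangle> \<le> \<langle>A\<^sub>+, Y\<rangle> \<le> t \<langle>A\<^sub>+, D\<rangle> = t e / n\<close>, that is \<open>e \<ge> n - n / t \<ge> n - \<vartheta>\<^sup>-\<close>.
  Working with \<open>\<delta>\<close>-optimal \<open>Y\<close> and with all \<open>s > t\<close> avoids showing that the optima are attained.
\<close>

section \<open>Spectral decomposition of symmetric matrices\<close>

lemma symmetric_inner_commute:
  fixes A :: "real ^ 'n ^ 'n::finite"
  assumes "transpose A = A"
  shows "x \<bullet> (A *v y) = y \<bullet> (A *v x)"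
proof -
  have "x \<bullet> (A *v y) = (transpose A *v x) \<bullet> y"
    by (simp only: transpose_matrix_vector dot_lmul_matrix)
  then show ?thesis by (simp only: assms inner_commute)
qed

text \<open>A maximiser of the Rayleigh quotient exists on the compact unit sphere of
  \<open>V\<close>; invariance of \<open>V\<close> makes the residual \<open>u\<close> an admissible
  direction of variation, which forces it to vanish.\<close>

lemma symmetric_unit_eigenvector:
  fixes A :: "real ^ 'n ^ 'n::finite"
  assumes sym: "transpose A = A" and V: "subspace V" "V \<noteq> {0}"
    and inv: "\<And>v. v \<in> V \<Longrightarrow> A *v v \<in> V"
  obtains v \<mu> where "v \<in> V" "norm v = 1" "A *v v = \<mu> *\<^sub>R v"
proof -
  have "compact (V \<inter> sphere 0 1)"
    by (simp add: V(1) closed_Int_compact closed_subspace)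
  moreover have "V \<inter> sphere 0 1 \<noteq> {}"
  proof -
    obtain w where w: "w \<in> V" "w \<noteq> 0"
      using V subspace_0 by blast
    then have "w /\<^sub>R norm w \<in> V \<inter> sphere 0 1"
      using V(1) by (simp add: subspace_scale)
    then show ?thesis by blast
  qed
  moreover have "continuous_on (V \<inter> sphere 0 1) (\<lambda>x. x \<bullet> (A *v x))"
    by (intro continuous_intros linear_continuous_on linear_linear[THEN iffD2]) auto
  ultimately have "\<exists>v\<in>V \<inter> sphere 0 1. \<forall>x\<in>V \<inter> sphere 0 1. x \<bullet> (A *v x) \<le> v \<bullet> (A *v v)"
    by (rule continuous_attains_sup)
  then obtain v where v: "v \<in> V" "norm v = 1"
    and max: "\<And>x. x \<in> V \<Longrightarrow> norm x = 1 \<Longrightarrow> x \<bullet> (A *v x) \<le> v \<bullet> (A *v v)"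
    by (auto simp: Ball_def)
  define \<mu> where "\<mu> = v \<bullet> (A *v v)"
  define g where "g x = \<mu> * (x \<bullet> x) - x \<bullet> (A *v x)" for x
  have g: "0 \<le> g x" if "x \<in> V" for x
  proof (cases "x = 0")
    case False
    have "(x /\<^sub>R norm x) \<bullet> (A *v (x /\<^sub>R norm x)) \<le> \<mu>"
      unfolding \<mu>_def using False V(1) that by (intro max) (auto simp: subspace_scale)
    then have "(x \<bullet> (A *v x)) / (x \<bullet> x) \<le> \<mu>"
      by (simp add: matrix_vector_mult_scaleR dot_square_norm power2_eq_square field_simps)
    then show ?thesis
      using False by (simp add: g_def field_simps)
  qed (simp add: g_def)
  define u where "u = \<mu> *\<^sub>R v - A *v v"
  have uV: "u \<in> V"
    unfolding u_def using V(1) v(1) inv by (intro subspace_diff subspace_scale)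
  text \<open>\<open>g\<close> is minimal at \<open>v\<close>, so its first variation in the direction \<open>u\<close> vanishes.\<close>
  have lin: "0 \<le> 2 * s * (u \<bullet> u) + s\<^sup>2 * g u" for s
  proof -
    have "0 \<le> g (v + s *\<^sub>R u)"
      using V(1) v(1) uV by (intro g subspace_add subspace_scale)
    also have "g (v + s *\<^sub>R u) = g v + 2 * s * (\<mu> * (u \<bullet> v) - u \<bullet> (A *v v)) + s\<^sup>2 * g u"
      using symmetric_inner_commute[OF sym, of v u]
      by (simp add: g_def algebra_simps inner_add inner_commute[of v u] power2_eq_square
          matrix_vector_right_distrib matrix_vector_mult_scaleR)
    also have "g v = 0"
      using v(2) by (simp add: g_def \<mu>_def dot_square_norm)
    also have "\<mu> * (u \<bullet> v) - u \<bullet> (A *v v) = u \<bullet> u"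
      by (simp add: u_def inner_diff_right)
    finally show ?thesis by simp
  qed
  have "u \<bullet> u = 0"
  proof (rule ccontr)
    assume "u \<bullet> u \<noteq> 0"
    then have pos: "0 < u \<bullet> u" by simp
    \<comment> \<open>A small negative step: \<open>s * g u\<close> is at least
      \<open>- (u \<bullet> u)\<close>, so the linear term dominates and the expression in
      \<open>lin\<close> would be negative. The \<open>+ 1\<close> keeps the denominator positive
      when \<open>g u = 0\<close>.\<close>
    define s where "s = - (u \<bullet> u) / (g u + 1)"
    have gu: "0 \<le> g u" by (rule g[OF uV])
    have s: "s < 0" unfolding s_def using pos gu by (simp add: divide_neg_pos)
    have "0 \<le> s * (2 * (u \<bullet> u) + s * g u)"
      using lin[of s] by (simp add: algebra_simps power2_eq_square)
    then have "2 * (u \<bullet> u) + s * g u \<le> 0"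
      using s by (simp add: zero_le_mult_iff)
    moreover have "s * g u \<ge> - (u \<bullet> u)"
      using pos gu by (simp add: s_def field_simps)
    ultimately show False using pos by linarith
  qed
  then have "A *v v = \<mu> *\<^sub>R v" by (simp add: u_def)
  with v show ?thesis by (rule that)
qed

text \<open>Split off one unit eigenvector; by symmetry its orthogonal complement within
  \<open>V\<close> is again invariant and has smaller dimension.\<close>

lemma symmetric_orthonormal_eigenvectors_span:
  fixes A :: "real ^ 'n ^ 'n::finite"
  assumes sym: "transpose A = A" and V: "subspace V"
    and inv: "\<And>v. v \<in> V \<Longrightarrow> A *v v \<in> V"
  shows "\<exists>B. pairwise orthogonal B \<and> (\<forall>b\<in>B. norm b = 1 \<and> (\<exists>\<mu>. A *v b = \<mu> *\<^sub>R b)) \<and> span B = V"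
  using V inv
proof (induction "dim V" arbitrary: V rule: less_induct)
  case less
  show ?case
  proof (cases "V = {0}")
    case True
    then show ?thesis by (intro exI[of _ "{}"]) (auto simp: pairwise_def)
  next
    case False
    obtain v \<mu> where v: "v \<in> V" "norm v = 1" "A *v v = \<mu> *\<^sub>R v"
      using symmetric_unit_eigenvector[OF sym less.prems(1) False less.prems(2)] by metis
    define W where "W = V \<inter> {x. orthogonal v x}"
    have W: "subspace W"
      unfolding W_def by (intro subspace_inter less.prems subspace_orthogonal_to_vector)
    have "v \<notin> W"
      using v(2) by (auto simp: W_def orthogonal_def)
    then have "W \<subset> V" using v(1) by (auto simp: W_def)
    then have dim: "dim W < dim V"
      by (metis W dim_psubset less.prems(1) span_eq_iff)
    have "A *v x \<in> W" if "x \<in> W" for x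
      using that less.prems(2) symmetric_inner_commute[OF sym, of v x]
      by (auto simp: W_def orthogonal_def v(3) inner_commute)
    from less.hyps[OF dim W this] obtain B where B: "pairwise orthogonal B"
      "\<forall>b\<in>B. norm b = 1 \<and> (\<exists>\<mu>. A *v b = \<mu> *\<^sub>R b)" "span B = W" by blast
    have orth: "orthogonal v b" if "b \<in> B" for b
      using that B(3) span_base[of b B] by (auto simp: W_def)
    have "span (insert v B) = V"
    proof
      show "span (insert v B) \<subseteq> V"
        using v(1) B(3) span_superset[of B] less.prems(1) \<open>W \<subset> V\<close>
        by (intro span_minimal) auto
      show "V \<subseteq> span (insert v B)"
      proof
        fix x assume x: "x \<in> V"
        have "x - (v \<bullet> x) *\<^sub>R v \<in> W"
          using x v less.prems(1)
          by (auto simp: W_def orthogonal_def inner_diff_right dot_square_norm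
              intro!: subspace_diff subspace_scale)
        then show "x \<in> span (insert v B)"
          unfolding B(3)[symmetric] span_insert by blast
      qed
    qed
    then show ?thesis
      using B v orth
      by (intro exI[of _ "insert v B"]) (auto simp: pairwise_insert orthogonal_commute)
  qed
qed

section \<open>Orthonormal eigenbases and functions of a symmetric matrix\<close>

definition eigenbasis :: "real ^ 'n ^ 'n::finite \<Rightarrow> ('n \<Rightarrow> real ^ 'n) \<Rightarrow> ('n \<Rightarrow> real) \<Rightarrow> bool" where
  "eigenbasis A u d \<longleftrightarrow> (\<forall>i j. u i \<bullet> u j = (if i = j then 1 else 0)) \<and> (\<forall>k. A *v u k = d k *\<^sub>R u k)"

theorem symmetric_eigenbasis:
  fixes A :: "real ^ 'n ^ 'n::finite"
  assumes sym: "transpose A = A"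
  obtains u d where "eigenbasis A u d"
proof -
  obtain B where B: "pairwise orthogonal B"
    "\<forall>b\<in>B. norm b = 1 \<and> (\<exists>\<mu>. A *v b = \<mu> *\<^sub>R b)" "span B = UNIV"
    using symmetric_orthonormal_eigenvectors_span[OF sym, of UNIV] by auto
  have ind: "independent B"
    using B by (intro pairwise_orthogonal_independent) auto
  have "card B = CARD('n)"
    using dim_span_eq_card_independent[OF ind] B(3) by simp
  then obtain u :: "'n \<Rightarrow> real ^ 'n" where u: "bij_betw u UNIV B"
    by (metis ind independent_imp_finite finite_same_card_bij finite_class.finite_UNIV)
  have uB: "u k \<in> B" for k using u by (auto simp: bij_betw_def)
  have "\<forall>k. \<exists>\<mu>. A *v u k = \<mu> *\<^sub>R u k"
    using B(2) uB by blast
  then have "\<exists>d. \<forall>k. A *v u k = d k *\<^sub>R u k"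
    by (rule choice)
  then obtain d where d: "\<forall>k. A *v u k = d k *\<^sub>R u k" ..
  have "u i \<bullet> u j = (if i = j then 1 else 0)" for i j
  proof (cases "i = j")
    case True
    have "norm (u j) = 1" using B(2) uB[of j] by blast
    then show ?thesis using True by (simp add: dot_square_norm)
  next
    case False
    then have "u i \<noteq> u j" using u by (auto simp: bij_betw_def inj_on_def)
    then have "orthogonal (u i) (u j)" using B(1) uB by (simp add: pairwise_def)
    then show ?thesis using False by (simp add: orthogonal_def)
  qed
  with d have "eigenbasis A u d" unfolding eigenbasis_def by blast
  then show ?thesis by (rule that)
qed

text \<open>Orthonormality says that the square matrix with columns \<open>u k\<close> has its
  transpose as left inverse; it is then also a right inverse, which gives the resolution of the
  identity.\<close>

lemma eigenbasis_complete:
  assumes "eigenbasis A u d"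
  shows "(\<Sum>k\<in>UNIV. u k $ i * u k $ j) = (if i = j then 1 else 0)"
proof -
  define U where "U = (\<chi> i k. u k $ i)"
  have "transpose U ** U = mat 1"
    using assms by (simp add: eigenbasis_def U_def matrix_matrix_mult_def transpose_def mat_def
        vec_eq_iff inner_vec_def)
  then have "U ** transpose U = mat 1"
    by (simp add: matrix_left_right_inverse)
  then show ?thesis
    by (auto simp: U_def matrix_matrix_mult_def transpose_def mat_def vec_eq_iff)
qed

text \<open>This is U diag(c) U^T for the matrix U with columns \<open>u k\<close>. With
  \<open>c k = f (d k)\<close> it is f(A) in the functional calculus.\<close>

definition spectral_matrix :: "('n::finite \<Rightarrow> real ^ 'n) \<Rightarrow> ('n \<Rightarrow> real) \<Rightarrow> real ^ 'n ^ 'n" where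
  "spectral_matrix u c = (\<chi> i j. \<Sum>k\<in>UNIV. c k * u k $ i * u k $ j)"

lemma eigenbasis_spectral_matrix:
  assumes "eigenbasis A u d"
  shows "spectral_matrix u d = A"
proof -
  have "A $ i $ j = (\<Sum>k\<in>UNIV. d k * u k $ i * u k $ j)" for i j
  proof -
    \<comment> \<open>Write A as A times the identity and expand the identity in the
      eigenbasis.\<close>
    have "A $ i $ j = (\<Sum>l\<in>UNIV. A $ i $ l * (\<Sum>k\<in>UNIV. u k $ l * u k $ j))"
      by (simp add: eigenbasis_complete[OF assms] if_distrib[of "\<lambda>x. _ * x"] cong: if_cong)
    also have "\<dots> = (\<Sum>k\<in>UNIV. (A *v u k) $ i * u k $ j)"
      unfolding matrix_vector_mult_def sum_distrib_left
      by (subst sum.swap) (simp add: sum_distrib_right mult.assoc)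
    finally show ?thesis
      using assms by (simp add: eigenbasis_def)
  qed
  then show ?thesis by (simp add: spectral_matrix_def vec_eq_iff)
qed

lemma spectral_matrix_mult:
  assumes "eigenbasis A u d"
  shows "spectral_matrix u b ** spectral_matrix u c = spectral_matrix u (\<lambda>k. b k * c k)"
proof -
  have "(spectral_matrix u b ** spectral_matrix u c) $ i $ j
      = (\<Sum>l\<in>UNIV. \<Sum>k\<in>UNIV. \<Sum>m\<in>UNIV. b k * c m * u k $ i * u m $ j * (u k $ l * u m $ l))" for i j
    by (simp add: spectral_matrix_def matrix_matrix_mult_def sum_product mult_ac)
  also have "\<dots> i j = (\<Sum>k\<in>UNIV. \<Sum>m\<in>UNIV. b k * c m * u k $ i * u m $ j * (u k \<bullet> u m))" for i j
    unfolding inner_vec_def sum_distrib_left inner_real_def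
    by (subst sum.swap, rule sum.cong[OF refl], rule sum.swap)
  finally show ?thesis
    using assms by (simp add: eigenbasis_def spectral_matrix_def vec_eq_iff
        if_distrib[of "\<lambda>x. _ * x"] mult_ac cong: if_cong)
qed

lemma spectral_matrix_inner:
  "spectral_matrix u c \<bullet> R = (\<Sum>k\<in>UNIV. c k * (u k \<bullet> (R *v u k)))"
proof -
  have "spectral_matrix u c \<bullet> R = (\<Sum>i\<in>UNIV. \<Sum>j\<in>UNIV. \<Sum>k\<in>UNIV. c k * (u k $ i * (R $ i $ j * u k $ j)))"
    by (simp add: spectral_matrix_def inner_vec_def sum_distrib_left sum_distrib_right mult_ac)
  also have "\<dots> = (\<Sum>i\<in>UNIV. \<Sum>k\<in>UNIV. \<Sum>j\<in>UNIV. c k * (u k $ i * (R $ i $ j * u k $ j)))"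
    by (rule sum.cong[OF refl], rule sum.swap)
  also have "\<dots> = (\<Sum>k\<in>UNIV. \<Sum>i\<in>UNIV. \<Sum>j\<in>UNIV. c k * (u k $ i * (R $ i $ j * u k $ j)))"
    by (rule sum.swap)
  finally show ?thesis
    by (simp add: inner_vec_def matrix_vector_mult_def sum_distrib_left)
qed

section \<open>From the characteristic polynomial to the eigenvalues \<open>d k\<close>\<close>

lemma sum_linear_poly: "(\<Sum>k\<in>K. [:f k, g k:]) = [:sum f K, sum g K:]"
  by (induction K rule: infinite_finite_induct) auto

lemma sum_const_poly: "(\<Sum>k\<in>K. [:f k:]) = [:sum f K:]"
  by (induction K rule: infinite_finite_induct) auto

text \<open>Over the polynomial ring, xI - A equals P D P^T with P constant and orthogonal, so its
  determinant is that of the diagonal matrix D.\<close>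

lemma charpoly_eigenbasis:
  assumes "eigenbasis A u d"
  shows "charpoly A = (\<Prod>k\<in>UNIV. [:- d k, 1:])"
proof -
  define P :: "real poly ^ 'a ^ 'a" where "P = (\<chi> i k. [:u k $ i:])"
  define D :: "real poly ^ 'a ^ 'a" where "D = (\<chi> i k. if i = k then [:- d k, 1:] else 0)"
  have PP: "P ** transpose P = mat 1"
    using eigenbasis_complete[OF assms]
    by (simp add: P_def matrix_matrix_mult_def transpose_def mat_def vec_eq_iff sum_const_poly)
  have "(P ** D ** transpose P) $ i $ j = (\<Sum>k\<in>UNIV. [:- (d k * u k $ i * u k $ j), u k $ i * u k $ j:])" for i j
    by (simp add: P_def D_def matrix_matrix_mult_def transpose_def mult_ac
        if_distrib[of "\<lambda>x. _ * x"] cong: if_cong)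
  also have "\<dots> i j = (if i = j then [:0, 1:] else 0) - [:A $ i $ j:]" for i j
    unfolding sum_linear_poly eigenbasis_complete[OF assms]
    by (subst eigenbasis_spectral_matrix[OF assms, symmetric])
      (simp add: spectral_matrix_def sum_negf)
  finally have "charpoly A = det (P ** D ** transpose P)"
    unfolding charpoly_def by (intro arg_cong[where f = det]) (simp add: vec_eq_iff)
  also have "\<dots> = det D * det (P ** transpose P)"
    by (simp add: det_mul)
  also have "\<dots> = (\<Prod>k\<in>UNIV. [:- d k, 1:])"
    unfolding PP det_I by (simp add: D_def det_diagonal)
  finally show ?thesis .
qed

lemma sum_proots_charpoly_eigenbasis:
  assumes "eigenbasis A u d"
  shows "(\<Sum>x\<in>#proots (charpoly A). f x) = (\<Sum>k\<in>UNIV. f (d k))"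
proof -
  have "proots (charpoly A) = (\<Sum>k\<in>UNIV. {#d k#})"
    unfolding charpoly_eigenbasis[OF assms] by (subst proots_prod) auto
  moreover have "(\<Sum>x\<in>#(\<Sum>k\<in>K. {#d k#}). f x) = (\<Sum>k\<in>K. f (d k))" for K
    by (induction K rule: infinite_finite_induct) auto
  ultimately show ?thesis by simp
qed

lemma spectral_matrix_algebra:
  assumes u: "eigenbasis A u d" and alg: "matrix_algebra \<A>" and A: "A \<in> \<A>" and I: "mat 1 \<in> \<A>"
  shows "spectral_matrix u (\<lambda>k. f (d k)) \<in> \<A>"
proof -
  have sub: "subspace \<A>" and mul: "\<And>X Y. X \<in> \<A> \<Longrightarrow> Y \<in> \<A> \<Longrightarrow> X ** Y \<in> \<A>"
    using alg by (auto simp: matrix_algebra_def)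
  have one: "spectral_matrix u (\<lambda>_. 1) = mat 1"
    by (simp add: spectral_matrix_def eigenbasis_complete[OF u] mat_def)
  have lin: "spectral_matrix u (\<lambda>k. x * b k + y * c k)
      = x *\<^sub>R spectral_matrix u b + y *\<^sub>R spectral_matrix u c" for x y b c
    by (simp add: spectral_matrix_def vec_eq_iff sum_distrib_left sum.distrib algebra_simps)
  text \<open>By Lagrange interpolation on the spectrum it suffices to treat products of affine functions.\<close>
  have prod: "spectral_matrix u (\<lambda>k. \<Prod>y\<in>Y. a y * d k + b y) \<in> \<A>" if "finite Y" for Y :: "real set" and a b
    using that
  proof (induction Y rule: finite_induct)
    case (insert y Y)
    have "spectral_matrix u (\<lambda>k. a y * d k + b y * 1) \<in> \<A>"
      unfolding lin one eigenbasis_spectral_matrix[OF u]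
      by (intro subspace_add subspace_scale sub A I)
    from mul[OF this insert.IH] show ?case
      using insert.hyps by (simp add: spectral_matrix_mult[OF u])
  qed (simp add: one I)
  define R where "R = range d"
  have R: "finite R" by (simp add: R_def)
  have Rd: "d k \<in> R" for k by (simp add: R_def)
  \<comment> \<open>The Lagrange basis polynomial at \<open>y\<close> evaluated at A, that is, the
    projection onto the eigenspace of \<open>y\<close>.\<close>
  define L where "L y = spectral_matrix u (\<lambda>k. \<Prod>z\<in>R - {y}. (1 / (y - z)) * d k + (- z / (y - z)))" for y
  have L: "L y = spectral_matrix u (\<lambda>k. if d k = y then 1 else 0)" for y
  proof -
    have "(\<Prod>z\<in>R - {y}. (1 / (y - z)) * d k + (- z / (y - z))) = (if d k = y then 1 else 0)" for k
    proof (cases "d k = y")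
      case True
      then show ?thesis
        by (auto intro!: prod.neutral simp flip: diff_divide_distrib)
    next
      case False
      then show ?thesis
        using R Rd by (auto intro!: prod_zero bexI[of _ "d k"])
    qed
    then show ?thesis by (simp add: L_def)
  qed
  have "spectral_matrix u (\<lambda>k. f (d k)) = (\<Sum>y\<in>R. f y *\<^sub>R L y)"
  proof -
    have "f (d k) = (\<Sum>y\<in>R. f y * (if d k = y then 1 else 0))" for k
      using R Rd by (simp add: if_distrib[of "\<lambda>x. _ * x"] cong: if_cong)
    then have "spectral_matrix u (\<lambda>k. f (d k))
        = spectral_matrix u (\<lambda>k. \<Sum>y\<in>R. f y * (if d k = y then 1 else 0))" by presburger
    also have "\<dots> = (\<Sum>y\<in>R. f y *\<^sub>R L y)"
      unfolding L spectral_matrix_def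
      by (simp add: vec_eq_iff sum_distrib_left sum_distrib_right sum.swap[of _ UNIV R] mult_ac)
    finally show ?thesis .
  qed
  also have "\<dots> \<in> \<A>"
    unfolding L_def by (intro subspace_sum sub subspace_scale prod) (use R in auto)
  finally show ?thesis .
qed

section \<open>Duality between the two theta programs\<close>

text \<open>Turns the quadratic form of a matrix into an inner product, so that semidefiniteness
  becomes a family of linear conditions on the matrix.\<close>

definition outer :: "real ^ 'n \<Rightarrow> real ^ 'n ^ 'n::finite" where
  "outer v = (\<chi> i j. v $ i * v $ j)"

lemma quadratic_form_outer: "v \<bullet> (M *v v) = M \<bullet> outer v"
  by (simp add: outer_def inner_vec_def matrix_vector_mult_def sum_distrib_left mult_ac)

lemma outer_inner_outer: "outer v \<bullet> outer w = (v \<bullet> w)\<^sup>2"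
  by (simp add: outer_def inner_vec_def power2_eq_square sum_product mult_ac)

lemma all_ones_outer: "all_ones = outer 1"
  by (simp add: all_ones_def outer_def vec_eq_iff)

lemma mat_inner_trace: "mat c \<bullet> X = c * (\<Sum>i\<in>UNIV. X $ i $ i)"
  by (simp add: mat_def inner_vec_def if_distrib[of "\<lambda>x. x * _"] sum_distrib_left cong: if_cong)

lemma all_ones_inner: "all_ones \<bullet> X = (\<Sum>i\<in>UNIV. \<Sum>j\<in>UNIV. X $ i $ j)"
  by (simp add: all_ones_def inner_vec_def)

lemma transpose_inner_transpose: "transpose X \<bullet> transpose Y = X \<bullet> Y"
  for X Y :: "real ^ 'n ^ 'm"
  unfolding inner_vec_def transpose_def by (simp, rule sum.swap)

text \<open>Used to test semidefiniteness on e_i and on e_i plus or minus e_j, which controls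
  diagonal entries and bounds off-diagonal ones by them.\<close>

lemma outer_axis_combination:
  "M \<bullet> outer (a *\<^sub>R axis i 1 + b *\<^sub>R axis j 1)
    = a\<^sup>2 * M $ i $ i + a * b * (M $ i $ j + M $ j $ i) + b\<^sup>2 * M $ j $ j"
  unfolding quadratic_form_outer[symmetric]
  by (simp add: matrix_vector_right_distrib matrix_vector_mult_scaleR inner_add_left inner_axis'
      matrix_vector_mult_basis column_def algebra_simps power2_eq_square)

text \<open>The feasible matrices of the program for \<open>\<vartheta>\<^sup>+\<close> of the complement of the graph.\<close>

definition theta_plus_feasible :: "('n::finite \<Rightarrow> 'n \<Rightarrow> bool) \<Rightarrow> (real ^ 'n ^ 'n) set" where
  "theta_plus_feasible E =
     {Y. transpose Y = Y \<and> (\<forall>v. 0 \<le> Y \<bullet> outer v) \<and> (\<Sum>i\<in>UNIV. Y $ i $ i) = 1 \<and>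
         (\<forall>i j. i \<noteq> j \<longrightarrow> \<not> E i j \<longrightarrow> Y $ i $ j \<le> 0)}"

text \<open>Makes the supremum of the program finite. Testing on e_i - e_j bounds each entry by the
  mean of two diagonal entries; the trace then bounds the total.\<close>

lemma theta_plus_feasible_le:
  fixes E :: "'n::finite \<Rightarrow> 'n \<Rightarrow> bool"
  assumes "Y \<in> theta_plus_feasible E"
  shows "all_ones \<bullet> Y \<le> CARD('n)"
proof -
  have "2 * Y $ i $ j \<le> Y $ i $ i + Y $ j $ j" for i j
  proof -
    have "Y $ j $ i = Y $ i $ j" "0 \<le> Y \<bullet> outer (1 *\<^sub>R axis i 1 + (-1) *\<^sub>R axis j 1)"
      using assms unfolding theta_plus_feasible_def
      by (auto simp: transpose_def vec_eq_iff)
    then show ?thesis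
      unfolding outer_axis_combination by simp
  qed
  then have "(\<Sum>i\<in>UNIV. \<Sum>j\<in>UNIV. 2 * Y $ i $ j) \<le> (\<Sum>i\<in>UNIV. \<Sum>j\<in>UNIV. Y $ i $ i + Y $ j $ j)"
    by (intro sum_mono)
  also have "\<dots> = 2 * (CARD('n) * (\<Sum>i\<in>UNIV. Y $ i $ i))"
    by (simp add: sum.distrib sum_distrib_left)
  finally show ?thesis
    using assms by (simp add: all_ones_inner theta_plus_feasible_def flip: sum_distrib_left)
qed

lemma mat_theta_plus_feasible:
  fixes E :: "'n::finite \<Rightarrow> 'n \<Rightarrow> bool"
  shows "mat (1 / CARD('n)) \<in> theta_plus_feasible E"
    and "all_ones \<bullet> (mat (1 / CARD('n)) :: real ^ 'n ^ 'n) = 1"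
proof -
  show "mat (1 / CARD('n)) \<in> theta_plus_feasible E"
    by (auto simp: theta_plus_feasible_def mat_inner_trace outer_def
        intro!: sum_nonneg divide_nonneg_nonneg)
      (auto simp: mat_def)
  show "all_ones \<bullet> (mat (1 / CARD('n)) :: real ^ 'n ^ 'n) = 1"
    by (subst inner_commute) (simp add: mat_inner_trace all_ones_def)
qed

lemma theta_plus_near_optimal_le_diagonal:
  fixes E :: "'n::finite \<Rightarrow> 'n \<Rightarrow> bool"
  assumes Y: "Y \<in> theta_plus_feasible E" "t - \<delta> \<le> all_ones \<bullet> Y"
    and t: "\<And>Z. Z \<in> theta_plus_feasible E \<Longrightarrow> all_ones \<bullet> Z \<le> t"
    and v: "norm v = 1"
  shows "Y \<bullet> outer v \<le> t * (\<Sum>i\<in>UNIV. Y $ i $ i * (v $ i)\<^sup>2) + \<delta>"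
proof -
  define C :: "real ^ 'n ^ 'n" where "C = (\<chi> i j. 1 + v $ i * v $ j)"
  have C: "0 \<le> C $ i $ j" for i j
  proof -
    \<comment> \<open>The unit norm enters here: it makes C entrywise nonnegative, so a Schur
      product with C preserves the sign condition on non-edges.\<close>
    have "\<bar>v $ i\<bar> \<le> 1" for i
      using component_le_norm_cart[of v i] v by simp
    then have "\<bar>v $ i * v $ j\<bar> \<le> 1"
      unfolding abs_mult by (intro mult_le_one) auto
    then show ?thesis by (auto simp: C_def)
  qed
  define Z where "Z = schur_prod Y C"
  have psd: "0 \<le> Y \<bullet> outer w" for w
    using Y by (auto simp: theta_plus_feasible_def)
  have diag: "0 \<le> Y $ i $ i" for i
    using psd[of "1 *\<^sub>R axis i 1 + 0 *\<^sub>R axis i 1"] unfolding outer_axis_combination by simp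
  define s where "s = 1 + (\<Sum>i\<in>UNIV. Y $ i $ i * (v $ i)\<^sup>2)"
  have s: "0 < s"
    unfolding s_def by (intro add_pos_nonneg sum_nonneg) (auto simp: diag)
  have trace: "(\<Sum>i\<in>UNIV. Z $ i $ i) = s"
    using Y by (simp add: Z_def C_def s_def schur_prod_def theta_plus_feasible_def
        distrib_left sum.distrib power2_eq_square)
  have "0 \<le> Z \<bullet> outer w" for w
  proof -
    \<comment> \<open>The Schur product with v v^T is congruence by diag(v), so both summands are
      quadratic forms of Y.\<close>
    have "Z \<bullet> outer w = Y \<bullet> outer w + Y \<bullet> outer (\<chi> i. v $ i * w $ i)"
      by (simp add: Z_def C_def schur_prod_def outer_def inner_vec_def sum.distrib algebra_simps)
    then show ?thesis using psd[of w] psd[of "\<chi> i. v $ i * w $ i"] by simp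
  qed
  then have "Z /\<^sub>R s \<in> theta_plus_feasible E"
    using Y(1) s trace C
    by (auto simp: theta_plus_feasible_def Z_def schur_prod_def transpose_def vec_eq_iff
        C_def mult.commute mult_le_0_iff divide_le_0_iff simp flip: sum_divide_distrib sum_distrib_left)
  from t[OF this] have "all_ones \<bullet> Z \<le> t * s"
    using s by (simp add: field_simps)
  moreover have "all_ones \<bullet> Z = all_ones \<bullet> Y + Y \<bullet> outer v"
    by (simp add: all_ones_def Z_def C_def schur_prod_def outer_def inner_vec_def
        distrib_left sum.distrib)
  ultimately show ?thesis
    using Y(2) by (simp add: s_def algebra_simps)
qed

text \<open>The dual certificate gives Q = sI + N with Q - J positive semidefinite. Hence Q is
  itself positive semidefinite, and it is entrywise nonnegative and zero on edges, so only its trace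
  has to be normalised.\<close>

lemma theta_minus_feasible_of_dual:
  fixes E :: "'n::finite \<Rightarrow> 'n \<Rightarrow> bool"
  assumes E: "simple_graph E" and s: "0 < s"
    and N: "transpose N = N" "\<And>i j. 0 \<le> N $ i $ j" "\<And>i j. i = j \<or> E i j \<Longrightarrow> N $ i $ j = 0"
    and psd: "\<And>v. 0 \<le> (mat s - all_ones + N) \<bullet> outer v"
  shows "\<exists>X\<in>theta_minus_feasible E. CARD('n) / s \<le> all_ones \<bullet> X"
proof -
  define Q where "Q = mat s + N"
  \<comment> \<open>The trace of Q is n s, because N has zero diagonal.\<close>
  define c where "c = 1 / (CARD('n) * s)"
  have c: "0 < c" using s by (simp add: c_def)
  have Q: "(outer 1 \<bullet> outer v) \<le> Q \<bullet> outer v" for v :: "real ^ 'n"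
    using psd[of v] by (simp add: Q_def all_ones_outer inner_diff_left inner_add_left)
  have "0 \<le> Q \<bullet> outer v" for v :: "real ^ 'n"
    using Q[of v] by (simp add: outer_inner_outer) (meson order_trans zero_le_power2)
  moreover have "transpose Q = Q"
    using N(1) by (simp add: Q_def transpose_def vec_eq_iff mat_def)
  ultimately have "psd (c *\<^sub>R Q)"
    unfolding psd_def quadratic_form_outer using c
    by (simp add: transpose_def vec_eq_iff)
  moreover have "0 \<le> (c *\<^sub>R Q) $ i $ j" for i j
    using c s N(2)[of i j] by (simp add: Q_def mat_def)
  moreover have "mat_inner (mat 1) (c *\<^sub>R Q) = 1"
    unfolding mat_inner_eq_inner mat_inner_trace using s N(3)
    by (simp add: Q_def mat_def c_def)
  moreover have "schur_prod (c *\<^sub>R Q) (adj_matrix E) = 0"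
    using E N(3)
    by (auto simp: schur_prod_def Q_def adj_matrix_def mat_def vec_eq_iff simple_graph_def irreflp_def)
  ultimately have "c *\<^sub>R Q \<in> theta_minus_feasible E"
    by (simp add: theta_minus_feasible_def)
  moreover have "CARD('n) / s \<le> all_ones \<bullet> (c *\<^sub>R Q)"
  proof -
    \<comment> \<open>Test Q - J on the all-ones vector.\<close>
    have "(real CARD('n))\<^sup>2 \<le> all_ones \<bullet> Q"
      using Q[of 1] by (simp add: outer_inner_outer all_ones_outer inner_commute[of Q])
        (simp add: inner_vec_def)
    then have "c * (real CARD('n))\<^sup>2 \<le> c * (all_ones \<bullet> Q)"
      using c by simp
    then show ?thesis by (simp add: c_def power2_eq_square)
  qed
  ultimately show ?thesis by blast
qed

text \<open>If no certificate N exists, the candidates S miss the cone T of matrices with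
  nonnegative quadratic form. A separating functional H, scaled to trace one, is then feasible with
  value at least \<open>s\<close>, against the strict bound.\<close>

lemma theta_plus_strong_duality:
  fixes E :: "'n::finite \<Rightarrow> 'n \<Rightarrow> bool"
  assumes E: "simple_graph E"
    and s: "\<And>Y. Y \<in> theta_plus_feasible E \<Longrightarrow> all_ones \<bullet> Y < s"
  obtains N where "transpose N = N" "\<And>i j. 0 \<le> N $ i $ j" "\<And>i j. i = j \<or> E i j \<Longrightarrow> N $ i $ j = 0"
    "\<And>v. 0 \<le> (mat s - all_ones + N) \<bullet> outer v"
proof (rule ccontr)
  assume "\<not> thesis"
  note no = this
  define \<N> :: "(real ^ 'n ^ 'n) set" where
    "\<N> = {N. transpose N = N \<and> (\<forall>i j. 0 \<le> N $ i $ j) \<and> (\<forall>i j. i = j \<or> E i j \<longrightarrow> N $ i $ j = 0)}"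
  define S where "S = (+) (mat s - all_ones) ` \<N>"
  text \<open>\<open>T\<close> also contains nonsymmetric matrices; this makes a separating functional \<open>H\<close> symmetric.\<close>
  define T :: "(real ^ 'n ^ 'n) set" where "T = {M. \<forall>v. 0 \<le> M \<bullet> outer v}"
  have scale: "c *\<^sub>R N \<in> \<N>" if "N \<in> \<N>" "0 \<le> c" for N c
    using that by (auto simp: \<N>_def transpose_def vec_eq_iff)
  have "0 \<in> \<N>" by (auto simp: \<N>_def transpose_def vec_eq_iff)
  have "S \<inter> T = {}"
  proof (rule ccontr)
    assume "S \<inter> T \<noteq> {}"
    then obtain N where "N \<in> \<N>" "mat s - all_ones + N \<in> T" by (auto simp: S_def)
    then have thesis
      by (intro that[of N]) (auto simp: \<N>_def T_def)
    with no show False ..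
  qed
  moreover have "convex S"
    unfolding S_def
    by (intro convex_translation) (auto simp: convex_def \<N>_def transpose_def vec_eq_iff)
  moreover have "convex T"
    by (auto simp: convex_def T_def inner_add_left)
  moreover have "S \<noteq> {}" "T \<noteq> {}"
    using \<open>0 \<in> \<N>\<close> by (auto simp: S_def T_def intro: exI[of _ 0])
  ultimately obtain H b where "H \<noteq> 0" and HS: "\<And>x. x \<in> S \<Longrightarrow> H \<bullet> x \<le> b"
    and HT: "\<And>x. x \<in> T \<Longrightarrow> b \<le> H \<bullet> x"
    using separating_hyperplane_sets[of S T] by blast
  have b: "b \<le> 0" using HT[of 0] by (simp add: T_def)
  have T: "0 \<le> H \<bullet> M" if "M \<in> T" for M
  proof (rule ccontr)
    assume neg: "\<not> 0 \<le> H \<bullet> M"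
    \<comment> \<open>Scaling within the cone T to the value \<open>b - 1\<close> would violate the
      lower bound \<open>b\<close>.\<close>
    define c where "c = (b - 1) / (H \<bullet> M)"
    have "0 \<le> c" using neg b by (simp add: c_def divide_nonpos_neg)
    then have "c *\<^sub>R M \<in> T" using that by (simp add: T_def)
    from HT[OF this] show False using neg by (simp add: c_def)
  qed
  have HJ: "H \<bullet> (mat s - all_ones) \<le> 0"
    using HS[of "mat s - all_ones"] \<open>0 \<in> \<N>\<close> b by (force simp: S_def)
  have HN: "H \<bullet> N \<le> 0" if "N \<in> \<N>" for N
  proof (rule ccontr)
    assume pos: "\<not> H \<bullet> N \<le> 0"
    \<comment> \<open>Chosen so that H takes the value 1 at a point of S, above the bound
      \<open>b\<close>, which is at most 0.\<close>
    define c where "c = (1 - H \<bullet> (mat s - all_ones)) / (H \<bullet> N)"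
    have "0 \<le> c" using pos HJ by (simp add: c_def)
    then have "mat s - all_ones + c *\<^sub>R N \<in> S" using scale[OF that] by (simp add: S_def)
    from HS[OF this] show False using pos b by (simp add: c_def inner_add_right)
  qed
  have sym: "transpose H = H"
  proof -
    \<comment> \<open>The antisymmetric matrix M has zero quadratic form, so both M and -M lie in T
      and H is orthogonal to it.\<close>
    define M where "M = H - transpose H"
    have tM: "transpose M = - M"
      by (simp add: M_def transpose_def vec_eq_iff)
    have "M \<bullet> outer v = 0" for v
    proof -
      have "M \<bullet> outer v = transpose M \<bullet> transpose (outer v)"
        by (simp only: transpose_inner_transpose)
      also have "transpose (outer v) = outer v"
        by (simp add: outer_def transpose_def vec_eq_iff mult.commute)
      finally show ?thesis by (simp add: tM)
    qed
    then have "M \<in> T" "- M \<in> T" by (auto simp: T_def)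
    from T[OF this(1)] T[OF this(2)] have "H \<bullet> M = 0" by simp
    moreover have "transpose H \<bullet> M = - (H \<bullet> M)"
      using transpose_inner_transpose[of "transpose H" M] by (simp add: tM)
    ultimately have "M \<bullet> M = 0" by (simp add: M_def inner_diff_left)
    then show ?thesis by (simp add: M_def)
  qed
  have symij: "H $ j $ i = H $ i $ j" for i j
    using sym by (simp add: transpose_def vec_eq_iff)
  have psd: "0 \<le> H \<bullet> outer v" for v
    by (intro T) (simp add: T_def outer_inner_outer)
  have diag: "0 \<le> H $ i $ i" for i
    using psd[of "1 *\<^sub>R axis i 1 + 0 *\<^sub>R axis i 1"] unfolding outer_axis_combination by simp
  define r where "r = (\<Sum>i\<in>UNIV. H $ i $ i)"
  have r: "0 < r"
  proof (rule ccontr)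
    assume "\<not> 0 < r"
    moreover have "0 \<le> r" unfolding r_def by (intro sum_nonneg diag)
    ultimately have "r = 0" by simp
    then have "H $ i $ i = 0" for i
      unfolding r_def by (subst (asm) sum_nonneg_eq_0_iff) (auto simp: diag)
    \<comment> \<open>With zero diagonal, the test vectors e_i + e_j and e_i - e_j bound the entry
      from both sides by zero.\<close>
    then have "H $ i $ j = 0" for i j
      using psd[of "1 *\<^sub>R axis i 1 + 1 *\<^sub>R axis j 1"] psd[of "1 *\<^sub>R axis i 1 + (-1) *\<^sub>R axis j 1"]
      unfolding outer_axis_combination by (simp add: symij[of j i])
    then show False using \<open>H \<noteq> 0\<close> by (simp add: vec_eq_iff)
  qed
  have nonedge: "H $ i $ j \<le> 0" if "i \<noteq> j" "\<not> E i j" for i j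
  proof -
    \<comment> \<open>The symmetric unit perturbation at one non-edge isolates the corresponding
      entry of H.\<close>
    define N :: "real ^ 'n ^ 'n" where "N = axis i (axis j 1) + axis j (axis i 1)"
    have "\<not> E j i" using that E by (auto simp: simple_graph_def symp_def)
    then have "N \<in> \<N>"
      using that by (auto simp: N_def \<N>_def transpose_def vec_eq_iff axis_def)
    then have "H \<bullet> N \<le> 0" by (rule HN)
    moreover have "H \<bullet> N = H $ i $ j + H $ j $ i"
      by (simp add: N_def inner_add_right inner_axis)
    ultimately show ?thesis by (simp add: symij[of j i])
  qed
  have "H /\<^sub>R r \<in> theta_plus_feasible E"
    using sym psd r nonedge
    by (auto simp: theta_plus_feasible_def transpose_def vec_eq_iff divide_le_0_iff mult_le_0_iff
        simp flip: sum_divide_distrib sum_distrib_left r_def)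
  from s[OF this] have "all_ones \<bullet> H < s * r"
    using r by (simp add: field_simps)
  moreover have "H \<bullet> mat s = s * r"
    by (subst inner_commute) (simp add: mat_inner_trace r_def)
  ultimately show False
    using HJ by (simp add: inner_diff_right inner_commute)
qed

section \<open>The energy bound\<close>

theorem theorem1p6:
  fixes E :: "'n::finite \<Rightarrow> 'n \<Rightarrow> bool"
  assumes "simple_graph E"
    and "highly_regular E"
  shows "1 / 2 * energy E \<ge> real CARD('n) - theta_minus E"
proof -
  define n where "n = real CARD('n)"
  have n: "0 < n" by (simp add: n_def)
  define t where "t = (SUP Y\<in>theta_plus_feasible E. all_ones \<bullet> Y)"
  have bdd: "bdd_above ((\<bullet>) all_ones ` theta_plus_feasible E)"
    by (rule bdd_aboveI2) (rule theta_plus_feasible_le)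
  have t: "all_ones \<bullet> Y \<le> t" if "Y \<in> theta_plus_feasible E" for Y
    unfolding t_def by (rule cSUP_upper[OF that bdd])
  have "1 \<le> t"
    using t[OF mat_theta_plus_feasible(1)] by (simp add: mat_theta_plus_feasible(2))
  have theta: "n \<le> t * theta_minus E"
  proof -
    have "n / s \<le> theta_minus E" if "t < s" for s
    proof -
      have "all_ones \<bullet> Y < s" if "Y \<in> theta_plus_feasible E" for Y
        using t[OF that] \<open>t < s\<close> by simp
      from theta_plus_strong_duality[OF assms(1) this] obtain N where
        "transpose N = N" "\<And>i j. 0 \<le> N $ i $ j" "\<And>i j. i = j \<or> E i j \<Longrightarrow> N $ i $ j = 0"
        "\<And>v. 0 \<le> (mat s - all_ones + N) \<bullet> outer v" by metis
      with theta_minus_feasible_of_dual[OF assms(1), of s N] obtain X where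
        "X \<in> theta_minus_feasible E" "n / s \<le> all_ones \<bullet> X"
        using \<open>1 \<le> t\<close> \<open>t < s\<close> unfolding n_def by fastforce
      then show ?thesis
        using theta_minus_is_max[OF assms(1)] unfolding mat_inner_eq_inner by (metis order_trans)
    qed
    then have *: "n \<le> s * theta_minus E" if "t < s" for s
      using that \<open>1 \<le> t\<close> by (force simp: field_simps)
    have "0 \<le> theta_minus E"
    proof -
      have "0 < (t + 1) * theta_minus E" using *[of "t + 1"] n by simp
      then show ?thesis using \<open>1 \<le> t\<close> by (simp add: zero_less_mult_iff)
    qed
    show ?thesis
    proof (rule field_le_epsilon)
      fix e :: real assume "0 < e"
      \<comment> \<open>Let s tend to t: this excess over t costs at most \<open>e\<close> after
        multiplication by \<open>theta_minus E\<close>, and the \<open>+ 1\<close> avoids division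
        by zero.\<close>
      then have "n \<le> (t + e / (theta_minus E + 1)) * theta_minus E"
        using \<open>0 \<le> theta_minus E\<close> by (intro *) simp
      also have "\<dots> \<le> t * theta_minus E + e"
        using \<open>0 < e\<close> \<open>0 \<le> theta_minus E\<close> by (simp add: field_simps)
      finally show "n \<le> t * theta_minus E + e" .
    qed
  qed

  define A where "A = adj_matrix E"
  have "transpose A = A"
    using assms(1) by (auto simp: A_def adj_matrix_def transpose_def vec_eq_iff simple_graph_def symp_def)
  then obtain u d where u: "eigenbasis A u d" by (rule symmetric_eigenbasis)
  define P where "P = spectral_matrix u (\<lambda>k. max 0 (d k))"
  \<comment> \<open>P lies in the algebra as a function of A, and every member of the algebra has
    constant diagonal.\<close>
  obtain c where c: "P $ i $ i = c" for i
    using assms(2) spectral_matrix_algebra[OF u, of _ "max 0"]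
    unfolding highly_regular_def A_def P_def by blast
  have irrefl: "\<not> E i i" for i
    using assms(1) by (simp add: simple_graph_def irreflp_def)
  have norm_u: "norm (u k) = 1" for k
    using u by (simp add: eigenbasis_def norm_eq_1)
  have trace: "(\<Sum>i\<in>UNIV. spectral_matrix u b $ i $ i) = (\<Sum>k\<in>UNIV. b k)" for b
    using spectral_matrix_inner[of u b "mat 1"] norm_u
    by (simp add: norm_eq_1 inner_commute[of _ "mat 1"] mat_inner_trace)
  define e where "e = (\<Sum>k\<in>UNIV. max 0 (d k))"
  have e: "e = n * c"
    using trace[of "\<lambda>k. max 0 (d k)"] by (simp add: e_def n_def c flip: P_def)
  have energy: "energy E = 2 * e"
  proof -
    \<comment> \<open>A has trace zero, so the positive eigenvalues carry exactly half of the
      energy.\<close>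
    have "(\<Sum>k\<in>UNIV. d k) = 0"
      using trace[of d] by (simp add: eigenbasis_spectral_matrix[OF u] A_def adj_matrix_def irrefl)
    moreover have "energy E = (\<Sum>k\<in>UNIV. \<bar>d k\<bar>)"
      unfolding energy_def A_def[symmetric] by (rule sum_proots_charpoly_eigenbasis[OF u])
    moreover have "\<bar>x\<bar> = 2 * max 0 x - x" for x :: real by auto
    ultimately show ?thesis
      by (simp add: e_def sum_subtractf sum_distrib_left)
  qed
  have "t - 1 \<le> t * c"
  proof (rule field_le_epsilon)
    fix \<epsilon> :: real assume \<epsilon>: "0 < \<epsilon>"
    have "0 \<le> e" unfolding e_def by (intro sum_nonneg) auto
    \<comment> \<open>The total error is one \<open>\<delta>\<close> from the suboptimality of Y and
      \<open>\<delta> * e\<close> from the quadratic-form bounds weighted by the positive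
      eigenvalues.\<close>
    define \<delta> where "\<delta> = \<epsilon> / (e + 1)"
    have \<delta>: "0 < \<delta>" "\<delta> * (e + 1) = \<epsilon>"
      using \<epsilon> \<open>0 \<le> e\<close> by (auto simp: \<delta>_def)
    have "t - \<delta> < t" using \<delta> by simp
    then obtain Y where Y: "Y \<in> theta_plus_feasible E" "t - \<delta> < all_ones \<bullet> Y"
      unfolding t_def using mat_theta_plus_feasible(1)[of E] bdd by (subst (asm) less_cSUP_iff) auto
    then have quad: "0 \<le> u k \<bullet> (Y *v u k)"
      "u k \<bullet> (Y *v u k) \<le> t * (\<Sum>i\<in>UNIV. Y $ i $ i * (u k $ i)\<^sup>2) + \<delta>" for k
      using theta_plus_near_optimal_le_diagonal[OF Y(1) less_imp_le[OF Y(2)] t norm_u]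
      unfolding quadratic_form_outer by (auto simp: theta_plus_feasible_def)
    have tr: "(\<Sum>i\<in>UNIV. Y $ i $ i) = 1"
      using Y(1) by (simp add: theta_plus_feasible_def)
    have "all_ones \<bullet> Y - 1 = (all_ones - mat 1) \<bullet> Y"
      by (simp add: inner_diff_left mat_inner_trace tr)
    \<comment> \<open>J - I and A differ only at non-edges, where Y is nonpositive.\<close>
    also have "\<dots> \<le> A \<bullet> Y"
      using Y(1) unfolding inner_vec_def inner_real_def
      by (intro sum_mono)
        (auto simp: theta_plus_feasible_def all_ones_def mat_def A_def adj_matrix_def irrefl)
    also have "\<dots> = (\<Sum>k\<in>UNIV. d k * (u k \<bullet> (Y *v u k)))"
      by (subst eigenbasis_spectral_matrix[OF u, symmetric]) (rule spectral_matrix_inner)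
    also have "\<dots> \<le> (\<Sum>k\<in>UNIV. max 0 (d k) * (t * (\<Sum>i\<in>UNIV. Y $ i $ i * (u k $ i)\<^sup>2) + \<delta>))"
    proof (rule sum_mono)
      fix k
      \<comment> \<open>Replacing A by its positive part can only increase the value, because Y is
        positive semidefinite.\<close>
      have "d k * (u k \<bullet> (Y *v u k)) \<le> max 0 (d k) * (u k \<bullet> (Y *v u k))"
        using quad(1) by (intro mult_right_mono) auto
      also have "\<dots> \<le> max 0 (d k) * (t * (\<Sum>i\<in>UNIV. Y $ i $ i * (u k $ i)\<^sup>2) + \<delta>)"
        using quad(2) by (intro mult_left_mono) auto
      finally show "d k * (u k \<bullet> (Y *v u k)) \<le> \<dots>" .
    qed
    also have "\<dots> = t * (\<Sum>k\<in>UNIV. \<Sum>i\<in>UNIV. Y $ i $ i * (max 0 (d k) * u k $ i * u k $ i)) + \<delta> * e"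
      by (simp add: e_def algebra_simps sum.distrib sum_distrib_left sum_distrib_right power2_eq_square)
    also have "(\<Sum>k\<in>UNIV. \<Sum>i\<in>UNIV. Y $ i $ i * (max 0 (d k) * u k $ i * u k $ i))
        = (\<Sum>i\<in>UNIV. Y $ i $ i * P $ i $ i)"
      by (subst sum.swap) (simp add: P_def spectral_matrix_def sum_distrib_left)
    also have "\<dots> = c"
      by (simp add: c tr flip: sum_distrib_right)
    finally show "t - 1 \<le> t * c + \<epsilon>"
      using Y(2) \<delta>(2) by (simp add: distrib_left)
  qed
  then have "n * (t - 1) \<le> n * (t * c)"
    using n by simp
  \<comment> \<open>Chains t n - t theta <= t n - n <= t n c = t e; dividing by the positive t
    finishes.\<close>
  with theta have "t * (n - theta_minus E) \<le> t * e"
    by (simp add: e algebra_simps)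
  then show ?thesis
    using \<open>1 \<le> t\<close> by (simp add: energy n_def)
qed

end
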